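(* Let $m\geqslant 3$. Let $(C_{m+1},\sigma_1)$ be a signed cycle on vertices $v_1,v_2,\dots,v_{m+1}$ with edges $v_iv_{i+1}$ ($1\leqslant i\leqslant m$) and $v_{m+1}v_1$, with ordered Laplacian spectrum $(\alpha_1,\dots,\alpha_{m+1})$. Let $(C_m,\sigma_2)$ be the signed cycle on vertices $v_1,\dots,v_m$ with edges $v_iv_{i+1}$ ($1\leqslant i\leqslant m-1$) and $v_mv_1$, where $\sigma_2(e)=\sigma_1(e)$ for every edge $e$ of $C_m$ other than $v_1v_m$, and $\sigma_2(v_1v_m)\in\{+,-\}$ is arbitrary; let $(\beta_1,\dots,\beta_m)$ be its ordered Laplacian spectrum. Then \[ \alpha_p-1\leqslant\beta_p\leqslant\alpha_{p+1}+2\quad\text{for } p=1,2,\dots,m. \]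
   Context: A signed graph $(G,\sigma)$ consists of a finite simple undirected graph $G$ and a map $\sigma:E(G)\to\{+1,-1\}$. The adjacency matrix has $(l,k)$ entry $\sigma(u_lu_k)$ if $u_l,u_k$ are adjacent and $0$ otherwise; the Laplacian is $L=D-A$ with $D$ the diagonal matrix of unsigned vertex degrees. The ordered spectrum is the list of eigenvalues with multiplicity in non-decreasing order. *)

theory Defs
  imports "Jordan_Normal_Form.Char_Poly"
begin

text \<open>
  A signed graph is given by an enumeration \<open>us\<close> of its vertices without repetition, its set
  \<open>E\<close> of edges (two-element sets of vertices), and a sign map \<open>\<sigma>\<close>, of which only the values on
  \<open>E\<close> matter. The enumeration fixes the indexing of the matrices below.
\<close>

definition signed_graph :: "'a list \<Rightarrow> 'a set set \<Rightarrow> ('a set \<Rightarrow> int) \<Rightarrow> bool" where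
  "signed_graph us E \<sigma> \<longleftrightarrow>
     distinct us \<and>
     E \<subseteq> {{u, w} | u w. u \<in> set us \<and> w \<in> set us \<and> u \<noteq> w} \<and>
     (\<forall>e \<in> E. \<sigma> e = 1 \<or> \<sigma> e = -1)"

definition adjacency_mat :: "'a list \<Rightarrow> 'a set set \<Rightarrow> ('a set \<Rightarrow> int) \<Rightarrow> real mat" where
  "adjacency_mat us E \<sigma> = mat (length us) (length us)
     (\<lambda>(l, k). if {us ! l, us ! k} \<in> E then of_int (\<sigma> {us ! l, us ! k}) else 0)"

definition degree_mat :: "'a list \<Rightarrow> 'a set set \<Rightarrow> real mat" where
  "degree_mat us E = mat (length us) (length us)
     (\<lambda>(l, k). if l = k then of_nat (card {e \<in> E. us ! l \<in> e}) else 0)"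

definition laplacian_mat :: "'a list \<Rightarrow> 'a set set \<Rightarrow> ('a set \<Rightarrow> int) \<Rightarrow> real mat" where
  "laplacian_mat us E \<sigma> = degree_mat us E - adjacency_mat us E \<sigma>"

text \<open>
  The real eigenvalues with algebraic multiplicity, in non-decreasing order. For a symmetric
  matrix these are all the eigenvalues; see \<open>length_ordered_spectrum\<close> below.
\<close>

definition ordered_spectrum :: "real mat \<Rightarrow> real list" where
  "ordered_spectrum A = sorted_list_of_multiset (proots (char_poly A))"

definition laplacian_spectrum :: "'a list \<Rightarrow> 'a set set \<Rightarrow> ('a set \<Rightarrow> int) \<Rightarrow> real list" where
  "laplacian_spectrum us E \<sigma> = ordered_spectrum (laplacian_mat us E \<sigma>)"

text \<open>The vertex \<open>v\<^sub>i\<close> is represented by the number \<open>i\<close>; the cycle has vertices \<open>1, \<dots>, n\<close>.\<close>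

definition cycle_vertices :: "nat \<Rightarrow> nat list" where
  "cycle_vertices n = [1..<n + 1]"

definition cycle_edges :: "nat \<Rightarrow> nat set set" where
  "cycle_edges n = {{i, i + 1} | i. 1 \<le> i \<and> i \<le> n - 1} \<union> {{n, 1}}"

lemma symmetric_eigenvalue_real:
  fixes A :: "real mat"
  assumes A: "A \<in> carrier_mat n n" and sym: "transpose_mat A = A"
    and ev: "eigenvalue (map_mat complex_of_real A) a"
  shows "a \<in> \<real>"
proof -
  have s: "A $$ (i, j) = A $$ (j, i)" if "i < n" "j < n" for i j
    using arg_cong[OF sym, of "\<lambda>M. M $$ (j, i)"] A that by simp
  obtain v where v: "v \<in> carrier_vec n" "v \<noteq> 0\<^sub>v n"
    and Bv: "map_mat complex_of_real A *\<^sub>v v = a \<cdot>\<^sub>v v"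
    using ev A unfolding eigenvalue_def eigenvector_def by auto
  have row: "(\<Sum>j<n. of_real (A $$ (i, j)) * v $ j) = a * v $ i" if "i < n" for i
  proof -
    have "(map_mat complex_of_real A *\<^sub>v v) $ i = a * v $ i"
      using that v by (simp add: Bv)
    then show ?thesis using that v A
      by (simp add: scalar_prod_def lessThan_atLeast0)
  qed
  define N where "N = (\<Sum>i<n. v $ i * cnj (v $ i))"
  have "a * N = (\<Sum>i<n. \<Sum>j<n. of_real (A $$ (i, j)) * v $ j * cnj (v $ i))"
    unfolding N_def sum_distrib_left
    by (rule sum.cong) (simp_all add: row[symmetric] sum_distrib_right mult.assoc[symmetric])
  also have "\<dots> = (\<Sum>j<n. \<Sum>i<n. of_real (A $$ (i, j)) * v $ j * cnj (v $ i))"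
    by (rule sum.swap)
  also have "\<dots> = (\<Sum>j<n. v $ j * cnj (\<Sum>i<n. of_real (A $$ (j, i)) * v $ i))"
    by (intro sum.cong) (simp_all add: s sum_distrib_left mult_ac)
  also have "\<dots> = (\<Sum>j<n. v $ j * cnj (a * v $ j))"
    by (intro sum.cong refl) (use row in simp)
  also have "\<dots> = cnj a * N"
    unfolding N_def sum_distrib_left by (simp add: mult_ac)
  finally have eq: "a * N = cnj a * N" .
  obtain i where i: "i < n" "v $ i \<noteq> 0"
    using v by (metis eq_vecI carrier_vecD index_zero_vec)
  have "N = of_real (\<Sum>i<n. (cmod (v $ i))\<^sup>2)"
    unfolding N_def by (simp add: complex_norm_square[symmetric])
  moreover have "(\<Sum>i<n. (cmod (v $ i))\<^sup>2) > 0"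
    by (rule sum_pos2[of _ i]) (use i in auto)
  ultimately have "N \<noteq> 0" by (metis less_irrefl of_real_eq_0_iff)
  with eq show ?thesis by (simp add: Reals_cnj_iff)
qed

lemma length_ordered_spectrum:
  fixes A :: "real mat"
  assumes A: "A \<in> carrier_mat n n" and sym: "transpose_mat A = A"
  shows "length (ordered_spectrum A) = n"
proof -
  interpret h: inj_comm_ring_hom complex_of_real
    by unfold_locales auto
  interpret hp: map_poly_inj_comm_ring_hom complex_of_real ..
  let ?B = "map_mat complex_of_real A"
  have B: "?B \<in> carrier_mat n n" using A by simp
  obtain as where as: "char_poly ?B = (\<Prod>a\<leftarrow>as. [:- a, 1:])" and len: "length as = n"
    using char_poly_factorized[OF B] by auto
  have real: "a \<in> \<real>" if "a \<in> set as" for a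
  proof -
    have "poly (char_poly ?B) a = 0"
      unfolding as using that by (auto simp: poly_prod_list prod_list_zero_iff)
    then show ?thesis
      using symmetric_eigenvalue_real[OF A sym] eigenvalue_root_char_poly[OF B] by blast
  qed
  have "map_poly complex_of_real (\<Prod>a\<leftarrow>as. [:- Re a, 1:]) = (\<Prod>a\<leftarrow>as. [:- a, 1:])"
    using real
  proof (induction as)
    case (Cons a as)
    have "map_poly complex_of_real [:- Re a, 1:] = [:- a, 1:]"
      using Cons.prems[of a] by simp
    then show ?case
      using Cons by (simp only: list.map prod_list.Cons hp.hom_mult list.set_intros)
  qed simp
  also have "\<dots> = map_poly complex_of_real (char_poly A)"
    unfolding as[symmetric] by (rule of_real_hom.char_poly_hom[OF A])
  finally have "char_poly A = (\<Prod>a\<leftarrow>as. [:- Re a, 1:])"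
    by simp
  moreover have "proots (\<Prod>a\<leftarrow>as. [:- Re a, 1:]) = mset (map Re as)"
  proof (induction as)
    case (Cons a as)
    let ?q = "\<Prod>a\<leftarrow>as. [:- Re a, 1:]"
    have "?q \<noteq> 0"
      by (auto simp: prod_list_zero_iff)
    then have "proots ([:- Re a, 1:] * ?q) = proots [:- Re a, 1:] + proots ?q"
      by (intro proots_mult) auto
    then show ?case
      using Cons unfolding list.map prod_list.Cons proots_linear_factor by simp
  qed simp
  ultimately show ?thesis
    unfolding ordered_spectrum_def
    by (metis len length_map mset_sorted_list_of_multiset size_mset)
qed

lemma length_laplacian_spectrum: "length (laplacian_spectrum us E \<sigma>) = length us"
  unfolding laplacian_spectrum_def
proof (rule length_ordered_spectrum)
  show "laplacian_mat us E \<sigma> \<in> carrier_mat (length us) (length us)"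
    by (intro carrier_matI) (simp_all add: laplacian_mat_def adjacency_mat_def degree_mat_def)
  show "transpose_mat (laplacian_mat us E \<sigma>) = laplacian_mat us E \<sigma>"
    by (intro eq_matI) (auto simp: laplacian_mat_def adjacency_mat_def degree_mat_def insert_commute)
qed

end

theory Submission
  imports Defs "Jordan_Normal_Form.Schur_Decomposition" "HOL-Combinatorics.Permutations"
begin

text \<open>
  Both bounds follow from the Courant--Fischer principle applied to the quadratic forms
  \<open>x \<bullet> (L *\<^sub>v x)\<close>, which are sums of one term \<open>(x\<^sub>i - s x\<^sub>j)\<^sup>2\<close> for each edge \<open>ij\<close> of sign \<open>s\<close>.
  For the lower bound, a vector \<open>y\<close> on the small cycle is extended linearly to the large one by the
  value \<open>t = a y\<^sub>m + b y\<^sub>1\<close> at the new vertex, where \<open>a\<close> and \<open>b\<close> are the signs of the two new edges;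
  whatever the signs, the form of the large cycle at \<open>(y, t)\<close> then exceeds that of the small cycle
  at \<open>y\<close> by at most \<open>y\<^sub>1\<^sup>2 + y\<^sub>m\<^sup>2 + t\<^sup>2\<close>. For the upper bound, only vectors
  vanishing at the new vertex are considered, and the form of the small cycle exceeds that of the
  large one by at most \<open>y\<^sub>1\<^sup>2 + y\<^sub>m\<^sup>2\<close>; this even gives \<open>\<beta>\<^sub>p \<le> \<alpha>\<^sub>p\<^sub>+\<^sub>1 + 1\<close>.
\<close>

section \<open>Ordered eigenvectors and the Courant--Fischer principle\<close>

text \<open>The conditions are the first \<open>q\<close> rows of a square matrix whose other rows
  are zero. It is singular because its transpose kills \<open>unit_vec n q\<close>.\<close>

lemma exists_orthogonal_vec:
  fixes w :: "nat \<Rightarrow> 'a :: field vec"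
  assumes "q < n" and w: "\<And>i. i < q \<Longrightarrow> w i \<in> carrier_vec n"
  obtains x where "x \<in> carrier_vec n" "x \<noteq> 0\<^sub>v n" "\<And>i. i < q \<Longrightarrow> w i \<bullet> x = 0"
proof -
  define M where "M = mat n n (\<lambda>(i, j). if i < q then w i $ j else 0)"
  have M: "M \<in> carrier_mat n n" by (simp add: M_def)
  have "M\<^sup>T *\<^sub>v unit_vec n q = 0\<^sub>v n"
    using assms(1) by (intro eq_vecI) (auto simp: M_def scalar_prod_def unit_vec_def intro!: sum.neutral)
  moreover have "unit_vec n q \<noteq> 0\<^sub>v n"
    using assms(1) by (metis index_unit_vec(2) index_zero_vec(1) zero_neq_one)
  ultimately have "det (M\<^sup>T) = 0"
    using det_0_iff_vec_prod_zero_field[of "M\<^sup>T" n] M unit_vec_carrier by (metis transpose_carrier_mat)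
  then have "det M = 0" using det_transpose[OF M] by simp
  then obtain x where x: "x \<in> carrier_vec n" "x \<noteq> 0\<^sub>v n" "M *\<^sub>v x = 0\<^sub>v n"
    using det_0_iff_vec_prod_zero_field[OF M] by auto
  have "w i \<bullet> x = 0" if "i < q" for i
  proof -
    have "row M i = w i" using that assms(1) w[OF that] by (auto simp: M_def)
    moreover have "(M *\<^sub>v x) $ i = row M i \<bullet> x" using that assms(1) M by simp
    ultimately show ?thesis using that assms(1) x by simp
  qed
  with x show ?thesis by (intro that)
qed

text \<open>As long as the degree is positive there is a root, and dividing out its linear factor
  lowers degree and number of roots by one each.\<close>

lemma split_of_size_proots:
  fixes p :: "'a :: field poly"
  assumes "p \<noteq> 0" "size (proots p) = degree p"
  shows "\<exists>es. p = Polynomial.smult (lead_coeff p) (\<Prod>e\<leftarrow>es. [:- e, 1:])"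
  using assms
proof (induction "degree p" arbitrary: p)
  case 0
  then obtain c where "p = [:c:]" by (metis degree_0_id)
  then show ?case by (intro exI[of _ "[]"]) simp
next
  case (Suc d)
  then have "proots p \<noteq> {#}" by force
  then obtain r where "r \<in># proots p" by blast
  then have "poly p r = 0" using Suc.prems by simp
  then obtain q where p: "p = [:- r, 1:] * q" by (auto simp: poly_eq_0_iff_dvd)
  have q: "q \<noteq> 0" using p Suc.prems by auto
  then have dq: "degree p = Suc (degree q)" unfolding p by (subst degree_mult_eq) auto
  have "proots p = add_mset r (proots q)" unfolding p using q by (subst proots_mult) auto
  then have "size (proots q) = degree q" using Suc.prems dq by simp
  then obtain es where es: "q = Polynomial.smult (lead_coeff q) (\<Prod>e\<leftarrow>es. [:- e, 1:])"
    using Suc.hyps(1)[of q] Suc.hyps(2) dq q by auto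
  have lc: "lead_coeff p = lead_coeff q" unfolding p lead_coeff_mult by simp
  show ?case
    by (rule exI[of _ "r # es"]) (subst p, subst es, simp only: lc list.map prod_list.Cons mult_smult_right)
qed

text \<open>\<open>length_ordered_spectrum\<close> only counts the real roots; as their number is
  the degree, the polynomial splits. The explicit factorization is what
  \<open>schur_decomposition\<close> takes as input.\<close>

lemma symmetric_char_poly_splits:
  fixes A :: "real mat"
  assumes "A \<in> carrier_mat n n" "A\<^sup>T = A"
  obtains es where "char_poly A = (\<Prod>e\<leftarrow>es. [:- e, 1:])"
proof -
  have "size (mset (ordered_spectrum A)) = n"
    unfolding size_mset by (rule length_ordered_spectrum[OF assms])
  then have "size (proots (char_poly A)) = degree (char_poly A)"
    using degree_monic_char_poly[OF assms(1)] by (simp add: ordered_spectrum_def)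
  moreover have "char_poly A \<noteq> 0" "lead_coeff (char_poly A) = 1"
    using degree_monic_char_poly[OF assms(1)] by auto
  ultimately show ?thesis using split_of_size_proots[of "char_poly A"] that by auto
qed

section \<open>The spectral theorem for real symmetric matrices\<close>

lemma symmetric_scalar_prod:
  fixes A :: "'a :: comm_semiring_0 mat"
  assumes "A \<in> carrier_mat n n" "A\<^sup>T = A" "x \<in> carrier_vec n" "y \<in> carrier_vec n"
  shows "(A *\<^sub>v x) \<bullet> y = x \<bullet> (A *\<^sub>v y)"
  using transpose_vec_mult_scalar[OF assms(1,4,3)] assms(2) by simp

lemma real_scalar_prod_self_eq_0:
  fixes x :: "real vec"
  assumes "x \<in> carrier_vec n" "x \<bullet> x = 0"
  shows "x = 0\<^sub>v n"
proof -
  have "conjugate x = x" by (intro eq_vecI) auto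
  then show ?thesis using conjugate_square_eq_0_vec[OF assms(1)] assms(2) by simp
qed

lemma real_scalar_prod_self_pos:
  fixes x :: "real vec"
  assumes "x \<in> carrier_vec n" "x \<noteq> 0\<^sub>v n"
  shows "x \<bullet> x > 0"
proof -
  have "x \<bullet> x \<ge> 0" by (auto simp: scalar_prod_def intro: sum_nonneg)
  then show ?thesis using real_scalar_prod_self_eq_0[OF assms(1)] assms(2) by linarith
qed

text \<open>
  In a Schur form of a symmetric matrix with no nonzero eigenvalue, the squared matrix kills each
  basis vector as soon as the matrix kills the preceding ones, and a symmetric matrix has the same
  kernel as its square.
\<close>

lemma symmetric_nonzero_eigenvalue:
  fixes A :: "real mat"
  assumes A: "A \<in> carrier_mat n n" and sym: "A\<^sup>T = A" and nz: "A \<noteq> 0\<^sub>m n n"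
  obtains \<mu> w where "\<mu> \<noteq> 0" "w \<in> carrier_vec n" "w \<noteq> 0\<^sub>v n" "A *\<^sub>v w = \<mu> \<cdot>\<^sub>v w"
proof (rule ccontr)
  assume neg: "\<not> thesis"
  note witness = that
  obtain es where es: "char_poly A = (\<Prod>e\<leftarrow>es. [:- e, 1:])"
    using symmetric_char_poly_splits[OF A sym] .
  obtain B P Q where "schur_decomposition A es = (B, P, Q)" by (metis prod_cases3)
  from schur_decomposition[OF A es this]
  have wit: "similar_mat_wit A B P Q" and tri: "upper_triangular B" and diag: "diag_mat B = es"
    by auto
  from wit A have B: "B \<in> carrier_mat n n" and P: "P \<in> carrier_mat n n" and Q: "Q \<in> carrier_mat n n"
    and PQ: "P * Q = 1\<^sub>m n" and QP: "Q * P = 1\<^sub>m n" and APBQ: "A = P * B * Q"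
    unfolding similar_mat_wit_def Let_def by auto
  have "e = 0" if "e \<in> set es" for e
  proof (rule ccontr)
    assume "e \<noteq> 0"
    have "poly (char_poly A) e = 0"
      unfolding es using that by (auto simp: poly_prod_list prod_list_zero_iff)
    then have "eigenvalue A e" using eigenvalue_root_char_poly[OF A] by simp
    then show False
      using neg witness \<open>e \<noteq> 0\<close> A
      unfolding eigenvalue_def eigenvector_def by auto
  qed
  then have "B $$ (i, i) = 0" if "i < n" for i
    using that B unfolding diag[symmetric] diag_mat_def by auto
  \<comment> \<open>So \<open>B\<close> is strictly upper triangular.\<close>
  with tri B have B0: "B $$ (i, j) = 0" if "j \<le> i" "i < n" for i j
    using that by (cases "i = j") auto
  have "A * P = P * B * (Q * P)"
    unfolding APBQ using P B Q by (subst assoc_mult_mat[of _ n n _ n _ n]) auto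
  then have AP: "A * P = P * B" using QP P B by simp
  define M where "M = A * P"
  have M: "M \<in> carrier_mat n n" using A P by (simp add: M_def)
  have kill: "A *\<^sub>v col P j = 0\<^sub>v n" if "j < n" for j
    using that
  proof (induction j rule: less_induct)
    case (less j)
    let ?y = "A *\<^sub>v col P j"
    have c: "col P j \<in> carrier_vec n" "col B j \<in> carrier_vec n" "?y \<in> carrier_vec n"
      using P A B less.prems by auto
    have y: "?y = P *\<^sub>v col B j"
      using col_mult2[OF A P less.prems] col_mult2[OF P B less.prems] AP by simp
    \<comment> \<open>\<open>A\<close> applied to \<open>?y\<close> is the combination of the
      columns \<open>k\<close> of \<open>A * P\<close> with weights \<open>B $$ (k, j)\<close>.
      Columns with \<open>k < j\<close> vanish by induction, and for \<open>k \<ge> j\<close> the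
      weight is zero.\<close>
    have "(A * P) $$ (a, k) * B $$ (k, j) = 0" if "a < n" "k < n" for a k
    proof (cases "k < j")
      case True
      then have "col (A * P) k = 0\<^sub>v n" using less.IH[OF True \<open>k < n\<close>] col_mult2[OF A P \<open>k < n\<close>] by simp
      then have "col (A * P) k $ a = 0" using that by simp
      then show ?thesis using that A P by simp
    qed (use B0 that in auto)
    then have "(A * P) *\<^sub>v col B j = 0\<^sub>v n"
      using M B less.prems unfolding M_def[symmetric]
      by (intro eq_vecI) (auto simp: scalar_prod_def intro!: sum.neutral)
    then have "A *\<^sub>v ?y = 0\<^sub>v n" unfolding y using assoc_mult_mat_vec[OF A P c(2)] by simp
    then have "?y \<bullet> ?y = 0"
      using symmetric_scalar_prod[OF A sym c(1) c(3)] c by simp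
    then show ?case using real_scalar_prod_self_eq_0 c by blast
  qed
  have "A * P = 0\<^sub>m n n"
  proof (rule eq_matI)
    fix i j assume ij: "i < dim_row (0\<^sub>m n n :: real mat)" "j < dim_col (0\<^sub>m n n :: real mat)"
    then have "col (A * P) j $ i = 0" using kill[of j] col_mult2[OF A P, of j] by simp
    then show "(A * P) $$ (i, j) = 0\<^sub>m n n $$ (i, j)" using ij A P by simp
  qed (use A P in auto)
  then have "P * B * Q = 0\<^sub>m n n" using AP Q by simp
  then show False using nz APBQ by simp
qed

text \<open>Subtracting the part of \<open>A\<close> spanned by the eigenvectors found so far leaves a symmetric matrix
  that kills them, so an eigenvector of it for a nonzero eigenvalue is orthogonal to them.\<close>

lemma symmetric_orthonormal_eigenvectors:
  fixes A :: "real mat"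
  assumes A: "A \<in> carrier_mat n n" and sym: "A\<^sup>T = A"
  shows "k \<le> n \<Longrightarrow> \<exists>v l. \<forall>i<k. v i \<in> carrier_vec n \<and> A *\<^sub>v v i = l i \<cdot>\<^sub>v v i \<and>
    (\<forall>j<k. v i \<bullet> v j = (if i = j then 1 else 0))"
proof (induction k)
  case (Suc k)
  then obtain v l where v: "\<And>i. i < k \<Longrightarrow> v i \<in> carrier_vec n"
    and Av: "\<And>i. i < k \<Longrightarrow> A *\<^sub>v v i = l i \<cdot>\<^sub>v v i"
    and orth: "\<And>i j. i < k \<Longrightarrow> j < k \<Longrightarrow> v i \<bullet> v j = (if i = j then 1 else 0)"
    by (metis Suc_leD)
  \<comment> \<open>\<open>S\<close> is the sum of the rank-one matrices \<open>l i\<close> times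
    \<open>v i\<close> times its transpose; it acts like \<open>A\<close> on the \<open>v i\<close>
    and as zero on their orthogonal complement.\<close>
  define S where "S = mat n n (\<lambda>(a, b). \<Sum>i<k. l i * v i $ a * v i $ b)"
  have S: "S \<in> carrier_mat n n" "S\<^sup>T = S"
    unfolding S_def by (auto intro!: eq_matI sum.cong)
  have Sx: "S *\<^sub>v x = vec n (\<lambda>a. \<Sum>i<k. l i * (v i \<bullet> x) * v i $ a)" if "x \<in> carrier_vec n" for x
  proof (rule eq_vecI)
    fix a assume "a < dim_vec (vec n (\<lambda>a. \<Sum>i<k. l i * (v i \<bullet> x) * v i $ a))"
    then have a: "a < n" by simp
    then have "(S *\<^sub>v x) $ a = (\<Sum>b<n. \<Sum>i<k. l i * v i $ a * v i $ b * x $ b)"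
      using that by (simp add: S_def scalar_prod_def sum_distrib_right atLeast0LessThan)
    also have "\<dots> = (\<Sum>i<k. \<Sum>b<n. l i * v i $ a * v i $ b * x $ b)" by (rule sum.swap)
    also have "\<dots> = (\<Sum>i<k. l i * (v i \<bullet> x) * v i $ a)"
      using that by (intro sum.cong)
        (simp_all add: scalar_prod_def sum_distrib_left sum_distrib_right atLeast0LessThan mult_ac)
    finally show "(S *\<^sub>v x) $ a = vec n (\<lambda>a. \<Sum>i<k. l i * (v i \<bullet> x) * v i $ a) $ a"
      using a by simp
  qed (simp add: S_def)
  have S0: "S *\<^sub>v x = 0\<^sub>v n" if "x \<in> carrier_vec n" "\<And>i. i < k \<Longrightarrow> v i \<bullet> x = 0" for x
    unfolding Sx[OF that(1)] by (intro eq_vecI) (auto simp: that(2))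
  have Sv: "S *\<^sub>v v j = l j \<cdot>\<^sub>v v j" if "j < k" for j
    unfolding Sx[OF v[OF that]] using v[OF that] that
    by (intro eq_vecI) (auto simp: orth if_distrib if_distribR sum.delta cong: if_cong)
  have "\<exists>x \<mu>. x \<in> carrier_vec n \<and> x \<noteq> 0\<^sub>v n \<and> A *\<^sub>v x = \<mu> \<cdot>\<^sub>v x \<and> (\<forall>i<k. v i \<bullet> x = 0)"
  proof (cases "A - S = 0\<^sub>m n n")
    \<comment> \<open>Here \<open>A\<close> vanishes on the whole orthogonal complement of the
      \<open>v i\<close>, so any nonzero vector in it is an eigenvector for the eigenvalue
      0.\<close>
    case True
    then have "(A - S) $$ (i, j) = 0" if "i < n" "j < n" for i j
      using that by simp
    then have "A = S" using A S(1) by (intro eq_matI) auto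
    moreover obtain x where "x \<in> carrier_vec n" "x \<noteq> 0\<^sub>v n" "\<And>i. i < k \<Longrightarrow> v i \<bullet> x = 0"
      using exists_orthogonal_vec[of k n v] v Suc.prems by auto
    ultimately show ?thesis using S0 by (intro exI[of _ x] exI[of _ 0]) auto
  next
    case False
    have AS: "A - S \<in> carrier_mat n n" by (rule minus_carrier_mat) (rule S)
    have symAS: "(A - S)\<^sup>T = A - S" using A S sym by (simp add: transpose_minus)
    obtain \<mu> w where \<mu>: "\<mu> \<noteq> 0" and w: "w \<in> carrier_vec n" "w \<noteq> 0\<^sub>v n"
      and eig: "(A - S) *\<^sub>v w = \<mu> \<cdot>\<^sub>v w"
      using symmetric_nonzero_eigenvalue[OF AS symAS False] by blast
    have minus: "(A - S) *\<^sub>v x = A *\<^sub>v x - S *\<^sub>v x" if "x \<in> carrier_vec n" for x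
      using A S(1) that by (rule minus_mult_distrib_mat_vec)
    have orth_w: "v i \<bullet> w = 0" if "i < k" for i
    proof -
      have "(A - S) *\<^sub>v v i = 0\<^sub>v n" using minus Av Sv v that by simp
      then have "v i \<bullet> (\<mu> \<cdot>\<^sub>v w) = 0"
        using symmetric_scalar_prod[OF AS symAS v[OF that] w(1)] eig w by simp
      then show ?thesis using \<mu> v[OF that] w by simp
    qed
    then have "A *\<^sub>v w = \<mu> \<cdot>\<^sub>v w" using minus[OF w(1)] eig S0[OF w(1)] A w by simp
    then show ?thesis using w orth_w by blast
  qed
  then obtain x \<mu> where x: "x \<in> carrier_vec n" "x \<noteq> 0\<^sub>v n" "A *\<^sub>v x = \<mu> \<cdot>\<^sub>v x"
    and vx: "\<And>i. i < k \<Longrightarrow> v i \<bullet> x = 0" by blast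
  define u where "u = (1 / sqrt (x \<bullet> x)) \<cdot>\<^sub>v x"
  have u: "u \<in> carrier_vec n" "A *\<^sub>v u = \<mu> \<cdot>\<^sub>v u" "u \<bullet> u = 1" "\<And>i. i < k \<Longrightarrow> v i \<bullet> u = 0"
    using x vx v A real_scalar_prod_self_pos[OF x(1,2)]
    by (auto simp: u_def mult_mat_vec smult_smult_assoc mult.commute)
  moreover have "u \<bullet> v i = 0" if "i < k" for i
    using comm_scalar_prod[OF u(1) v[OF that]] u(4)[OF that] by simp
  ultimately show ?case
    using v Av orth by (intro exI[of _ "v(k := u)"] exI[of _ "l(k := \<mu>)"]) (auto simp: less_Suc_eq)
qed simp

text \<open>The matrix \<open>P\<close> with columns \<open>v j\<close> satisfies
  \<open>P\<^sup>T * P = 1\<^sub>m n\<close>. Being square it also satisfies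
  \<open>P * P\<^sup>T = 1\<^sub>m n\<close>, and this product can be inserted between
  \<open>x\<close> and \<open>y\<close>.\<close>

lemma parseval:
  fixes v :: "nat \<Rightarrow> 'a :: field vec"
  assumes v: "\<And>i. i < n \<Longrightarrow> v i \<in> carrier_vec n"
    and orth: "\<And>i j. i < n \<Longrightarrow> j < n \<Longrightarrow> v i \<bullet> v j = (if i = j then 1 else 0)"
    and x: "x \<in> carrier_vec n" and y: "y \<in> carrier_vec n"
  shows "x \<bullet> y = (\<Sum>i<n. (v i \<bullet> x) * (v i \<bullet> y))"
proof -
  define P where "P = mat n n (\<lambda>(i, j). v j $ i)"
  have P: "P \<in> carrier_mat n n" by (simp add: P_def)
  have col: "col P j = v j" if "j < n" for j using v[OF that] that by (auto simp: P_def)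
  have "P\<^sup>T * P = 1\<^sub>m n"
    using P by (intro eq_matI) (auto simp: col orth)
  then have "P * P\<^sup>T = 1\<^sub>m n" using mat_mult_left_right_inverse[of "P\<^sup>T" n P] P by auto
  then have "x \<bullet> y = x \<bullet> (P *\<^sub>v (P\<^sup>T *\<^sub>v y))"
    using P y by (subst assoc_mult_mat_vec[symmetric, of _ n n _ n]) auto
  also have "\<dots> = (P\<^sup>T *\<^sub>v x) \<bullet> (P\<^sup>T *\<^sub>v y)"
    using transpose_vec_mult_scalar[OF P _ x, of "P\<^sup>T *\<^sub>v y"] P y by simp
  also have "\<dots> = (\<Sum>i<n. (v i \<bullet> x) * (v i \<bullet> y))"
    using P by (simp add: scalar_prod_def[of "P\<^sup>T *\<^sub>v x"] col atLeast0LessThan)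
  finally show ?thesis .
qed

text \<open>An orthonormal eigenbasis diagonalizes \<open>A\<close>, so its eigenvalues
  \<open>l i\<close> are the roots of the characteristic polynomial with multiplicity. The ordered
  spectrum is therefore a rearrangement of them, and the eigenvectors are rearranged alike.\<close>

lemma symmetric_ordered_eigenvectors:
  fixes A :: "real mat"
  assumes A: "A \<in> carrier_mat n n" and sym: "A\<^sup>T = A"
  obtains v where "\<And>i. i < n \<Longrightarrow> v i \<in> carrier_vec n"
    "\<And>i. i < n \<Longrightarrow> A *\<^sub>v v i = (ordered_spectrum A ! i) \<cdot>\<^sub>v v i"
    "\<And>i j. i < n \<Longrightarrow> j < n \<Longrightarrow> v i \<bullet> v j = (if i = j then 1 else 0)"
proof -
  obtain v l where v: "\<And>i. i < n \<Longrightarrow> v i \<in> carrier_vec n"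
    and Av: "\<And>i. i < n \<Longrightarrow> A *\<^sub>v v i = l i \<cdot>\<^sub>v v i"
    and orth: "\<And>i j. i < n \<Longrightarrow> j < n \<Longrightarrow> v i \<bullet> v j = (if i = j then 1 else 0)"
    using symmetric_orthonormal_eigenvectors[OF A sym order_refl] by metis
  define P where "P = mat n n (\<lambda>(i, j). v j $ i)"
  define D where "D = mat n n (\<lambda>(i, j). if i = j then l i else 0)"
  have P: "P \<in> carrier_mat n n" and D: "D \<in> carrier_mat n n" by (simp_all add: P_def D_def)
  have col: "col P j = v j" if "j < n" for j using v[OF that] that by (auto simp: P_def)
  have PtP: "P\<^sup>T * P = 1\<^sub>m n"
    using P by (intro eq_matI) (auto simp: col orth)
  then have PPt: "P * P\<^sup>T = 1\<^sub>m n" using mat_mult_left_right_inverse[of "P\<^sup>T" n P] P by auto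
  have "A * P = P * D"
  proof (rule eq_matI)
    fix i j assume "i < dim_row (P * D)" "j < dim_col (P * D)"
    then have ij: "i < n" "j < n" using P D by auto
    have "(A * P) $$ (i, j) = (A *\<^sub>v v j) $ i" using ij A P by (simp add: col)
    also have "\<dots> = l j * v j $ i" using Av v ij by (metis carrier_vecD index_smult_vec(1))
    also have "\<dots> = (P * D) $$ (i, j)"
      using ij by (simp add: P_def D_def scalar_prod_def if_distrib cong: if_cong)
    finally show "(A * P) $$ (i, j) = (P * D) $$ (i, j)" .
  qed (use A P D in auto)
  then have "A = P * D * P\<^sup>T"
    using A P PPt by (metis assoc_mult_mat right_mult_one_mat transpose_carrier_mat)
  then have "similar_mat A D"
    using A P D PtP PPt by (intro similar_matI[of _ _ P "P\<^sup>T" n]) auto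
  then have "char_poly A = (\<Prod>a\<leftarrow>diag_mat D. [:- a, 1:])"
    using D by (subst char_poly_similar) (auto intro!: char_poly_upper_triangular simp: D_def)
  also have "diag_mat D = map l [0..<n]" by (simp add: diag_mat_def D_def)
  finally have cp: "char_poly A = (\<Prod>a\<leftarrow>map l [0..<n]. [:- a, 1:])" .
  have "proots (\<Prod>a\<leftarrow>xs. [:- a, 1:]) = mset xs" for xs :: "real list"
  proof (induction xs)
    case (Cons x xs)
    have "(\<Prod>a\<leftarrow>xs. [:- a, 1:]) \<noteq> 0" by (auto simp: prod_list_zero_iff)
    then have "proots ([:- x, 1:] * (\<Prod>a\<leftarrow>xs. [:- a, 1:])) = proots [:- x, 1:] + proots (\<Prod>a\<leftarrow>xs. [:- a, 1:])"
      by (intro proots_mult) auto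
    then show ?case using Cons unfolding list.map prod_list.Cons proots_linear_factor by simp
  qed simp
  then have "mset (ordered_spectrum A) = mset (map l [0..<n])"
    by (simp only: ordered_spectrum_def cp mset_sorted_list_of_multiset)
  then obtain p where p: "p permutes {..<length (map l [0..<n])}"
    and perm: "permute_list p (map l [0..<n]) = ordered_spectrum A"
    by (rule mset_eq_permutation)
  have p_less: "p i < n" if "i < n" for i using permutes_in_image[OF p, of i] that by simp
  have "ordered_spectrum A ! i = l (p i)" if "i < n" for i
    unfolding perm[symmetric] using permute_list_nth[OF p] that p_less by simp
  moreover have "p i = p j \<longleftrightarrow> i = j" for i j using permutes_inj[OF p] by (auto dest: injD)
  ultimately show ?thesis
    using v Av orth p_less by (intro that[of "v \<circ> p"]) auto
qed

section \<open>Courant-Fischer bounds\<close>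

lemma ordered_spectrum_mono:
  assumes "i \<le> j" "j < length (ordered_spectrum A)"
  shows "ordered_spectrum A ! i \<le> ordered_spectrum A ! j"
  using assms unfolding ordered_spectrum_def by (intro sorted_nth_mono) auto

text \<open>The \<open>w i\<close> are the first \<open>q\<close> eigenvectors: a vector orthogonal
  to them has components only along eigenvectors whose eigenvalue is at least the one at index
  \<open>q\<close>.\<close>

lemma courant_fischer_lower:
  fixes A :: "real mat"
  assumes A: "A \<in> carrier_mat n n" and sym: "A\<^sup>T = A" and q: "q < n"
  obtains w where "\<And>i. i < q \<Longrightarrow> w i \<in> carrier_vec n"
    "\<And>x. x \<in> carrier_vec n \<Longrightarrow> (\<And>i. i < q \<Longrightarrow> w i \<bullet> x = 0) \<Longrightarrow>
      ordered_spectrum A ! q * (x \<bullet> x) \<le> x \<bullet> (A *\<^sub>v x)"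
proof -
  obtain v where v: "\<And>i. i < n \<Longrightarrow> v i \<in> carrier_vec n"
    and Av: "\<And>i. i < n \<Longrightarrow> A *\<^sub>v v i = (ordered_spectrum A ! i) \<cdot>\<^sub>v v i"
    and orth: "\<And>i j. i < n \<Longrightarrow> j < n \<Longrightarrow> v i \<bullet> v j = (if i = j then 1 else 0)"
    using symmetric_ordered_eigenvectors[OF A sym] by blast
  have "ordered_spectrum A ! q * (x \<bullet> x) \<le> x \<bullet> (A *\<^sub>v x)"
    if x: "x \<in> carrier_vec n" and perp: "\<And>i. i < q \<Longrightarrow> v i \<bullet> x = 0" for x
  proof -
    have "ordered_spectrum A ! q * (x \<bullet> x) = (\<Sum>i<n. ordered_spectrum A ! q * (v i \<bullet> x)\<^sup>2)"
      by (simp add: parseval[OF v orth x x] sum_distrib_left power2_eq_square)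
    also have "\<dots> \<le> (\<Sum>i<n. ordered_spectrum A ! i * (v i \<bullet> x)\<^sup>2)"
    proof (rule sum_mono)
      fix i assume i: "i \<in> {..<n}"
      show "ordered_spectrum A ! q * (v i \<bullet> x)\<^sup>2 \<le> ordered_spectrum A ! i * (v i \<bullet> x)\<^sup>2"
      proof (cases "i < q")
        case False
        then show ?thesis using i length_ordered_spectrum[OF A sym]
          by (intro mult_right_mono ordered_spectrum_mono) auto
      qed (simp add: perp)
    qed
    \<comment> \<open>By symmetry \<open>A\<close> moves onto \<open>v i\<close>, where it becomes
      multiplication by the eigenvalue.\<close>
    also have "\<dots> = (\<Sum>i<n. (v i \<bullet> x) * (v i \<bullet> (A *\<^sub>v x)))"
      using symmetric_scalar_prod[OF A sym v x] v x
      by (intro sum.cong) (simp_all add: Av power2_eq_square flip: symmetric_scalar_prod[OF A sym v x])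
    also have "\<dots> = x \<bullet> (A *\<^sub>v x)"
      using parseval[OF v orth x] A x by simp
    finally show ?thesis .
  qed
  then show ?thesis using v q by (intro that[of v]) auto
qed

text \<open>Orthogonality to all but \<open>q + 1\<close> of the eigenvectors and to the \<open>w i\<close> amounts to \<open>n - 1\<close>
  linear conditions, so it has a nonzero solution.\<close>

lemma courant_fischer_upper:
  fixes A :: "real mat"
  assumes A: "A \<in> carrier_mat n n" and sym: "A\<^sup>T = A" and q: "q < n"
    and w: "\<And>i. i < q \<Longrightarrow> w i \<in> carrier_vec n"
  obtains x where "x \<in> carrier_vec n" "x \<noteq> 0\<^sub>v n" "\<And>i. i < q \<Longrightarrow> w i \<bullet> x = 0"
    "x \<bullet> (A *\<^sub>v x) \<le> ordered_spectrum A ! q * (x \<bullet> x)"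
proof -
  obtain v where v: "\<And>i. i < n \<Longrightarrow> v i \<in> carrier_vec n"
    and Av: "\<And>i. i < n \<Longrightarrow> A *\<^sub>v v i = (ordered_spectrum A ! i) \<cdot>\<^sub>v v i"
    and orth: "\<And>i j. i < n \<Longrightarrow> j < n \<Longrightarrow> v i \<bullet> v j = (if i = j then 1 else 0)"
    using symmetric_ordered_eigenvectors[OF A sym] by blast
  \<comment> \<open>The shift by \<open>Suc\<close> from index \<open>q\<close> on skips
    \<open>v q\<close>, leaving \<open>n - 1\<close> conditions; \<open>v 0\<close>, ...,
    \<open>v q\<close> remain available to \<open>x\<close>.\<close>
  define u where "u i = (if i < q then w i else v (Suc i))" for i
  have "u i \<in> carrier_vec n" if "i < n - 1" for i
    using that w v by (simp add: u_def)
  then obtain x where x: "x \<in> carrier_vec n" "x \<noteq> 0\<^sub>v n"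
    and perp: "\<And>i. i < n - 1 \<Longrightarrow> u i \<bullet> x = 0"
    using exists_orthogonal_vec[of "n - 1" n u] q by auto
  have wx: "w i \<bullet> x = 0" if "i < q" for i using perp[of i] that q by (simp add: u_def)
  have vx: "v i \<bullet> x = 0" if "q < i" "i < n" for i
  proof -
    have "i - 1 < n - 1" "\<not> i - 1 < q" "Suc (i - 1) = i" using that by auto
    then show ?thesis using perp[of "i - 1"] by (simp add: u_def)
  qed
  have "x \<bullet> (A *\<^sub>v x) = (\<Sum>i<n. (v i \<bullet> x) * (v i \<bullet> (A *\<^sub>v x)))"
    using parseval[OF v orth x(1)] A x by simp
  also have "\<dots> = (\<Sum>i<n. ordered_spectrum A ! i * (v i \<bullet> x)\<^sup>2)"
    using v x
    by (intro sum.cong) (simp_all add: Av power2_eq_square flip: symmetric_scalar_prod[OF A sym v x(1)])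
  also have "\<dots> \<le> (\<Sum>i<n. ordered_spectrum A ! q * (v i \<bullet> x)\<^sup>2)"
  proof (rule sum_mono)
    fix i assume i: "i \<in> {..<n}"
    show "ordered_spectrum A ! i * (v i \<bullet> x)\<^sup>2 \<le> ordered_spectrum A ! q * (v i \<bullet> x)\<^sup>2"
    proof (cases "q < i")
      case False
      then show ?thesis using i q length_ordered_spectrum[OF A sym]
        by (intro mult_right_mono ordered_spectrum_mono) auto
    qed (use i vx in simp)
  qed
  also have "\<dots> = ordered_spectrum A ! q * (x \<bullet> x)"
    by (simp add: parseval[OF v orth x(1) x(1)] sum_distrib_left power2_eq_square)
  finally show ?thesis using x wx by (intro that[of x]) auto
qed

section \<open>Laplacian forms of signed cycles\<close>

lemma laplacian_mat_carrier: "laplacian_mat us E \<sigma> \<in> carrier_mat (length us) (length us)"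
  by (intro carrier_matI) (simp_all add: laplacian_mat_def adjacency_mat_def degree_mat_def)

lemma laplacian_mat_symmetric: "(laplacian_mat us E \<sigma>)\<^sup>T = laplacian_mat us E \<sigma>"
  by (intro eq_matI) (auto simp: laplacian_mat_def adjacency_mat_def degree_mat_def insert_commute)

text \<open>Double counting turns the sums over matrix entries into a sum over edges. Reading
  \<open>x\<close> as a function \<open>f\<close> on vertices lets each summand depend on the
  unordered edge alone, with no choice of orientation.\<close>

lemma laplacian_quadratic_form:
  assumes g: "signed_graph us E \<sigma>" and x: "x \<in> carrier_vec (length us)"
    and f: "\<And>i. i < length us \<Longrightarrow> f (us ! i) = x $ i"
  shows "x \<bullet> (laplacian_mat us E \<sigma> *\<^sub>v x)
    = (\<Sum>e\<in>E. (\<Sum>u\<in>e. (f u)\<^sup>2) - 2 * of_int (\<sigma> e) * (\<Prod>u\<in>e. f u))"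
proof -
  let ?n = "length us" and ?V = "set us"
  have dist: "distinct us" and EV: "E \<subseteq> {{u, w} | u w. u \<in> ?V \<and> w \<in> ?V \<and> u \<noteq> w}"
    using g by (auto simp: signed_graph_def)
  have "E \<subseteq> Pow ?V" using EV by auto
  then have fin: "finite E" by (rule finite_subset) simp
  have bij: "bij_betw ((!) us) {..<?n} ?V" by (rule bij_betw_nth[OF dist]) auto
  define d where "d u = real (card {e \<in> E. u \<in> e}) * (f u)\<^sup>2" for u
  define a where "a u w = (if {u, w} \<in> E then of_int (\<sigma> {u, w}) * f u * f w else 0)" for u w
  have "x \<bullet> (laplacian_mat us E \<sigma> *\<^sub>v x)
      = (\<Sum>i<?n. \<Sum>j<?n. x $ i * laplacian_mat us E \<sigma> $$ (i, j) * x $ j)"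
    using x laplacian_mat_carrier[of us E \<sigma>]
    by (simp add: scalar_prod_def atLeast0LessThan sum_distrib_left mult.assoc)
  also have "\<dots> = (\<Sum>i<?n. \<Sum>j<?n. (if i = j then d (us ! i) else 0) - a (us ! i) (us ! j))"
    by (intro sum.cong refl)
      (auto simp: laplacian_mat_def adjacency_mat_def degree_mat_def d_def a_def f power2_eq_square algebra_simps)
  also have "\<dots> = (\<Sum>i<?n. d (us ! i)) - (\<Sum>i<?n. \<Sum>j<?n. a (us ! i) (us ! j))"
    by (simp add: sum_subtractf)
  also have "(\<Sum>i<?n. d (us ! i)) = (\<Sum>u\<in>?V. d u)" by (rule sum.reindex_bij_betw[OF bij])
  \<comment> \<open>The degree is written as a sum over incident edges, so that the order of
    summation can be exchanged.\<close>
  also have "\<dots> = (\<Sum>u\<in>?V. \<Sum>e\<in>E. if u \<in> e then (f u)\<^sup>2 else 0)"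
    unfolding d_def using fin by (intro sum.cong refl) (simp add: sum.If_cases Int_def)
  also have "\<dots> = (\<Sum>e\<in>E. \<Sum>u\<in>?V. if u \<in> e then (f u)\<^sup>2 else 0)" by (rule sum.swap)
  also have "\<dots> = (\<Sum>e\<in>E. \<Sum>u\<in>e. (f u)\<^sup>2)"
  proof (rule sum.cong[OF refl])
    fix e assume "e \<in> E"
    then have "?V \<inter> e = e" using \<open>E \<subseteq> Pow ?V\<close> by auto
    then show "(\<Sum>u\<in>?V. if u \<in> e then (f u)\<^sup>2 else 0) = (\<Sum>u\<in>e. (f u)\<^sup>2)"
      using sum.inter_restrict[of ?V "\<lambda>u. (f u)\<^sup>2" e] by simp
  qed
  also have "(\<Sum>i<?n. \<Sum>j<?n. a (us ! i) (us ! j)) = (\<Sum>i<?n. \<Sum>w\<in>?V. a (us ! i) w)"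
    by (intro sum.cong refl sum.reindex_bij_betw[OF bij])
  also have "\<dots> = (\<Sum>u\<in>?V. \<Sum>w\<in>?V. a u w)" by (rule sum.reindex_bij_betw[OF bij])
  also have "\<dots> = (\<Sum>(u, w)\<in>?V \<times> ?V. a u w)" by (rule sum.cartesian_product)
  also have "\<dots> = (\<Sum>(u, w)\<in>{p \<in> ?V \<times> ?V. {fst p, snd p} \<in> E}. a u w)"
    by (rule sum.mono_neutral_right) (auto simp: a_def split: if_splits)
  \<comment> \<open>Ordered pairs are grouped by their edge; each edge comes from exactly two of
    them, whence the factor 2.\<close>
  also have "\<dots> = (\<Sum>e\<in>E. \<Sum>(u, w)\<in>{p \<in> {p \<in> ?V \<times> ?V. {fst p, snd p} \<in> E}. {fst p, snd p} = e}. a u w)"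
    by (rule sum.group[symmetric]) (use fin in auto)
  also have "\<dots> = (\<Sum>e\<in>E. 2 * of_int (\<sigma> e) * (\<Prod>u\<in>e. f u))"
  proof (rule sum.cong[OF refl])
    fix e assume e: "e \<in> E"
    then obtain u w where uw: "e = {u, w}" "u \<in> ?V" "w \<in> ?V" "u \<noteq> w" using EV by blast
    have flip: "{w, u} = {u, w}" by (rule insert_commute)
    have pairs: "{p \<in> {p \<in> ?V \<times> ?V. {fst p, snd p} \<in> E}. {fst p, snd p} = e} = {(u, w), (w, u)}"
    proof (intro equalityI subsetI)
      fix p assume "p \<in> {p \<in> {p \<in> ?V \<times> ?V. {fst p, snd p} \<in> E}. {fst p, snd p} = e}"
      then have "{fst p, snd p} = {u, w}" using uw(1) by simp
      then show "p \<in> {(u, w), (w, u)}" by (cases p) (auto simp: doubleton_eq_iff)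
    next
      fix p assume "p \<in> {(u, w), (w, u)}"
      then have "{fst p, snd p} = e" "p \<in> ?V \<times> ?V" using uw(1-3) flip by (elim insertE emptyE; simp)+
      then show "p \<in> {p \<in> {p \<in> ?V \<times> ?V. {fst p, snd p} \<in> E}. {fst p, snd p} = e}"
        using e by simp
    qed
    have "a w u = a u w" unfolding a_def flip by simp
    then have "(\<Sum>(u, w)\<in>{(u, w), (w, u)}. a u w) = 2 * a u w" using uw(4) by simp
    also have "a u w = of_int (\<sigma> e) * (\<Prod>u\<in>e. f u)" using uw(4) e unfolding uw(1) a_def by simp
    finally show "(\<Sum>(u, w)\<in>{p \<in> {p \<in> ?V \<times> ?V. {fst p, snd p} \<in> E}. {fst p, snd p} = e}. a u w)
        = 2 * of_int (\<sigma> e) * (\<Prod>u\<in>e. f u)"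
      unfolding pairs by simp
  qed
  finally show ?thesis by (simp add: sum_subtractf)
qed

text \<open>The vertex \<open>u\<close> has coordinate \<open>u - 1\<close>, so the summand
  \<open>i\<close> belongs to the path edge joining the vertices \<open>i + 1\<close> and
  \<open>i + 2\<close>; the last term is the closing edge.\<close>

lemma cycle_laplacian_quadratic_form:
  assumes n: "n \<ge> 3" and g: "signed_graph (cycle_vertices n) (cycle_edges n) \<sigma>"
    and x: "x \<in> carrier_vec n"
  shows "x \<bullet> (laplacian_mat (cycle_vertices n) (cycle_edges n) \<sigma> *\<^sub>v x)
    = (\<Sum>i<n - 1. (x $ i)\<^sup>2 + (x $ Suc i)\<^sup>2 - 2 * of_int (\<sigma> {i + 1, i + 2}) * x $ i * x $ Suc i)
      + ((x $ (n - 1))\<^sup>2 + (x $ 0)\<^sup>2 - 2 * of_int (\<sigma> {n, 1}) * x $ (n - 1) * x $ 0)"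
proof -
  let ?q = "\<lambda>e. (\<Sum>u\<in>e. (x $ (u - 1))\<^sup>2) - 2 * of_int (\<sigma> e) * (\<Prod>u\<in>e. x $ (u - 1))"
  have edges: "cycle_edges n = insert {n, 1} ((\<lambda>i. {i + 1, i + 2}) ` {..<n - 1})"
  proof -
    have "{{i, i + 1} | i. 1 \<le> i \<and> i \<le> n - 1} = (\<lambda>i. {i + 1, i + 2}) ` {..<n - 1}" (is "?l = ?r")
    proof (intro equalityI subsetI)
      fix e assume "e \<in> ?l"
      then obtain i where "e = {i, i + 1}" "1 \<le> i" "i \<le> n - 1" by blast
      then show "e \<in> ?r" by (intro image_eqI[of _ _ "i - 1"]) auto
    next
      fix e assume "e \<in> ?r"
      then obtain i where "e = {i + 1, i + 2}" "i < n - 1" by blast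
      then show "e \<in> ?l" by (intro CollectI exI[of _ "i + 1"]) auto
    qed
    then show ?thesis unfolding cycle_edges_def by simp
  qed
  have inj: "inj_on (\<lambda>i::nat. {i + 1, i + 2}) {..<n - 1}"
    by (auto simp: inj_on_def doubleton_eq_iff)
  \<comment> \<open>For \<open>n = 2\<close> the closing edge would coincide with the path edge
    \<open>{1, 2}\<close>.\<close>
  have notin: "{n, 1} \<notin> (\<lambda>i. {i + 1, i + 2}) ` {..<n - 1}"
  proof
    assume "{n, 1} \<in> (\<lambda>i. {i + 1, i + 2}) ` {..<n - 1}"
    then obtain i where "{n, 1} = {i + 1, i + 2}" by blast
    then have "n = i + 1 \<and> 1 = i + 2 \<or> n = i + 2 \<and> 1 = i + 1" by (simp only: doubleton_eq_iff)
    with n show False by linarith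
  qed
  have "x \<bullet> (laplacian_mat (cycle_vertices n) (cycle_edges n) \<sigma> *\<^sub>v x) = (\<Sum>e\<in>cycle_edges n. ?q e)"
    using x by (intro laplacian_quadratic_form[OF g, where f = "\<lambda>u. x $ (u - 1)"])
      (auto simp: cycle_vertices_def simp del: upt_Suc)
  also have "\<dots> = ?q {n, 1} + (\<Sum>i<n - 1. ?q {i + 1, i + 2})"
    unfolding edges sum.insert[OF finite_imageI[OF finite_lessThan] notin]
      sum.reindex[OF inj] comp_def ..
  also have "(\<Sum>i<n - 1. ?q {i + 1, i + 2})
      = (\<Sum>i<n - 1. (x $ i)\<^sup>2 + (x $ Suc i)\<^sup>2 - 2 * of_int (\<sigma> {i + 1, i + 2}) * x $ i * x $ Suc i)"
    by (intro sum.cong) simp_all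
  finally show ?thesis using n by simp
qed

section \<open>Comparison of the Laplacian forms of the two cycles\<close>

lemma signed_square_nonneg:
  fixes u v s :: real
  assumes "s = 1 \<or> s = -1"
  shows "0 \<le> u\<^sup>2 + v\<^sup>2 - 2 * s * u * v"
proof -
  have "u\<^sup>2 + v\<^sup>2 - 2 * s * u * v = (u - s * v)\<^sup>2"
    using assms by (auto simp: power2_eq_square algebra_simps)
  then show ?thesis by simp
qed

text \<open>The new vertex \<open>v\<^sub>m\<^sub>+\<^sub>1\<close> gets the value \<open>t\<close>; its neighbours have values \<open>u\<close> and \<open>v\<close>.\<close>

lemma subdivided_edge_form_le:
  fixes a b s u v :: real
  assumes "a = 1 \<or> a = -1" "b = 1 \<or> b = -1" "s = 1 \<or> s = -1"
  defines "t \<equiv> a * u + b * v"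
  shows "(u\<^sup>2 + t\<^sup>2 - 2 * a * u * t) + (t\<^sup>2 + v\<^sup>2 - 2 * b * t * v)
    \<le> (u\<^sup>2 + v\<^sup>2 - 2 * s * u * v) + (u\<^sup>2 + v\<^sup>2 + t\<^sup>2)"
proof -
  \<comment> \<open>By the choice of \<open>t\<close> the cross terms on the left add up to
    \<open>- 2 * t\<^sup>2\<close>, so the left side is \<open>u\<^sup>2 + v\<^sup>2\<close>. The
    right side exceeds it by \<open>(u - s * v)\<^sup>2 + t\<^sup>2\<close>, and both of these
    squares are of the form \<open>(u + v)\<^sup>2\<close> or
    \<open>(u - v)\<^sup>2\<close>.\<close>
  have "0 \<le> (u + v)\<^sup>2" "0 \<le> (u - v)\<^sup>2" "0 \<le> u\<^sup>2" "0 \<le> v\<^sup>2" by simp_all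
  then show ?thesis using assms(1-3) unfolding t_def
    by (elim disjE) (simp_all add: power2_eq_square algebra_simps)
qed

context
  fixes m :: nat and \<sigma>1 \<sigma>2 :: "nat set \<Rightarrow> int"
  assumes m: "m \<ge> 3"
    and g1: "signed_graph (cycle_vertices (m + 1)) (cycle_edges (m + 1)) \<sigma>1"
    and g2: "signed_graph (cycle_vertices m) (cycle_edges m) \<sigma>2"
    and agree: "\<forall>e \<in> cycle_edges m - {{1, m}}. \<sigma>2 e = \<sigma>1 e"
begin

abbreviation "L1 \<equiv> laplacian_mat (cycle_vertices (m + 1)) (cycle_edges (m + 1)) \<sigma>1"
abbreviation "L2 \<equiv> laplacian_mat (cycle_vertices m) (cycle_edges m) \<sigma>2"
abbreviation "extend_vec y t \<equiv> vec (m + 1) (\<lambda>i. if i < m then y $ i else t :: real)"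

lemma L1_carrier: "L1 \<in> carrier_mat (m + 1) (m + 1)"
  using laplacian_mat_carrier[of "cycle_vertices (m + 1)"] by (simp add: cycle_vertices_def del: upt_Suc)

lemma L2_carrier: "L2 \<in> carrier_mat m m"
  using laplacian_mat_carrier[of "cycle_vertices m"] by (simp add: cycle_vertices_def del: upt_Suc)

lemma edge_signs:
  shows "\<sigma>1 {m, m + 1} = 1 \<or> \<sigma>1 {m, m + 1} = -1" "\<sigma>1 {m + 1, 1} = 1 \<or> \<sigma>1 {m + 1, 1} = -1"
    and "\<sigma>2 {m, 1} = 1 \<or> \<sigma>2 {m, 1} = -1"
proof -
  have "{m, m + 1} \<in> cycle_edges (m + 1)" "{m + 1, 1} \<in> cycle_edges (m + 1)" "{m, 1} \<in> cycle_edges m"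
    using m by (auto simp: cycle_edges_def)
  then show "\<sigma>1 {m, m + 1} = 1 \<or> \<sigma>1 {m, m + 1} = -1" "\<sigma>1 {m + 1, 1} = 1 \<or> \<sigma>1 {m + 1, 1} = -1"
    "\<sigma>2 {m, 1} = 1 \<or> \<sigma>2 {m, 1} = -1"
    using g1 g2 unfolding signed_graph_def by blast+
qed

lemma path_edge_sign:
  assumes "i < m - 1"
  shows "\<sigma>2 {i + 1, i + 2} = \<sigma>1 {i + 1, i + 2}" "\<sigma>2 {i + 1, i + 2} = 1 \<or> \<sigma>2 {i + 1, i + 2} = -1"
proof -
  have "\<exists>j. {i + 1, i + 2} = {j, j + 1} \<and> 1 \<le> j \<and> j \<le> m - 1"
    using assms by (intro exI[of _ "i + 1"]) auto
  then have "{i + 1, i + 2} \<in> cycle_edges m" unfolding cycle_edges_def by blast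
  moreover have "{i + 1, i + 2} \<noteq> {1, m}" using assms m by (auto simp: doubleton_eq_iff)
  ultimately show "\<sigma>2 {i + 1, i + 2} = \<sigma>1 {i + 1, i + 2}" "\<sigma>2 {i + 1, i + 2} = 1 \<or> \<sigma>2 {i + 1, i + 2} = -1"
    using agree g2 unfolding signed_graph_def by blast+
qed

text \<open>Every edge contributes a square. The lower bound uses this to know that the eigenvalues
  of \<open>L2\<close> are nonnegative.\<close>

lemma L2_nonneg:
  assumes "y \<in> carrier_vec m"
  shows "0 \<le> y \<bullet> (L2 *\<^sub>v y)"
  unfolding cycle_laplacian_quadratic_form[OF m g2 assms]
proof (intro add_nonneg_nonneg sum_nonneg signed_square_nonneg)
  show "real_of_int (\<sigma>2 {m, 1}) = 1 \<or> real_of_int (\<sigma>2 {m, 1}) = - 1" using edge_signs(3) by auto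
next
  fix i assume "i \<in> {..<m - 1}"
  then show "real_of_int (\<sigma>2 {i + 1, i + 2}) = 1 \<or> real_of_int (\<sigma>2 {i + 1, i + 2}) = - 1"
    using path_edge_sign(2)[of i] by auto
qed

text \<open>The forms share the \<open>m - 1\<close> path edges of the small cycle. What remains is
  its closing edge on one side and the two edges at the new vertex on the other.\<close>

lemma L1_extend_vec:
  assumes y: "y \<in> carrier_vec m"
  shows "extend_vec y t \<bullet> (L1 *\<^sub>v extend_vec y t) + ((y $ (m - 1))\<^sup>2 + (y $ 0)\<^sup>2 - 2 * of_int (\<sigma>2 {m, 1}) * y $ (m - 1) * y $ 0)
    = y \<bullet> (L2 *\<^sub>v y)
      + (((y $ (m - 1))\<^sup>2 + t\<^sup>2 - 2 * of_int (\<sigma>1 {m, m + 1}) * y $ (m - 1) * t)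
         + (t\<^sup>2 + (y $ 0)\<^sup>2 - 2 * of_int (\<sigma>1 {m + 1, 1}) * t * y $ 0))"
proof -
  let ?x = "extend_vec y t"
  let ?f = "\<lambda>i. (?x $ i)\<^sup>2 + (?x $ Suc i)\<^sup>2 - 2 * of_int (\<sigma>1 {i + 1, i + 2}) * ?x $ i * ?x $ Suc i"
  obtain k where k: "m = Suc k" using m by (cases m) auto
  \<comment> \<open>The summand \<open>m - 1\<close> is the edge from vertex \<open>m\<close> to the
    new vertex.\<close>
  have "(\<Sum>i<m. ?f i) = (\<Sum>i<m - 1. ?f i) + ?f (m - 1)" unfolding k by simp
  also have "(\<Sum>i<m - 1. ?f i)
      = (\<Sum>i<m - 1. (y $ i)\<^sup>2 + (y $ Suc i)\<^sup>2 - 2 * of_int (\<sigma>2 {i + 1, i + 2}) * y $ i * y $ Suc i)"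
  proof (rule sum.cong[OF refl])
    fix i assume "i \<in> {..<m - 1}"
    then have "i < m" "Suc i < m" "i < m - 1" by auto
    then show "?f i = (y $ i)\<^sup>2 + (y $ Suc i)\<^sup>2 - 2 * of_int (\<sigma>2 {i + 1, i + 2}) * y $ i * y $ Suc i"
      using path_edge_sign(1)[of i] by simp
  qed
  finally have "(\<Sum>i<m. ?f i)
      = (\<Sum>i<m - 1. (y $ i)\<^sup>2 + (y $ Suc i)\<^sup>2 - 2 * of_int (\<sigma>2 {i + 1, i + 2}) * y $ i * y $ Suc i)
        + ((y $ (m - 1))\<^sup>2 + t\<^sup>2 - 2 * of_int (\<sigma>1 {m, m + 1}) * y $ (m - 1) * t)"
    by (simp add: k)
  then show ?thesis
    using cycle_laplacian_quadratic_form[OF _ g1, of ?x] cycle_laplacian_quadratic_form[OF m g2 y] m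
    by simp
qed

lemma extend_vec_norm:
  assumes "y \<in> carrier_vec m"
  shows "extend_vec y t \<bullet> extend_vec y t = y \<bullet> y + t\<^sup>2"
  using assms by (simp add: scalar_prod_def power2_eq_square atLeast0LessThan)

text \<open>As \<open>m \<ge> 3\<close>, the indices \<open>m - 1\<close> and \<open>0\<close>
  differ, so these are two separate terms of the norm.\<close>

lemma end_entries_norm:
  assumes "y \<in> carrier_vec m"
  shows "(y $ (m - 1))\<^sup>2 + (y $ 0)\<^sup>2 \<le> (y \<bullet> y :: real)"
proof -
  have "(\<Sum>i\<in>{m - 1, 0}. (y $ i)\<^sup>2) \<le> (\<Sum>i<m. (y $ i)\<^sup>2)"
    using m by (intro sum_mono2) auto
  then show ?thesis using m assms by (simp add: scalar_prod_def power2_eq_square atLeast0LessThan)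
qed

section \<open>The two eigenvalue bounds\<close>

text \<open>Extension by \<open>t\<close> is linear in \<open>y\<close>, so the \<open>q\<close>
  conditions for \<open>L1\<close> pull back to \<open>q\<close> conditions on \<open>y\<close>, and
  both spectra are taken at the same index.\<close>

lemma spectrum_lower:
  assumes q: "q < m"
  shows "ordered_spectrum L1 ! q - 1 \<le> ordered_spectrum L2 ! q"
proof -
  define a b :: real where "a = of_int (\<sigma>1 {m, m + 1})" and "b = of_int (\<sigma>1 {m + 1, 1})"
  let ?\<alpha> = "ordered_spectrum L1 ! q" and ?\<beta> = "ordered_spectrum L2 ! q"
  obtain w where w: "\<And>i. i < q \<Longrightarrow> w i \<in> carrier_vec (m + 1)"
    and low: "\<And>x. x \<in> carrier_vec (m + 1) \<Longrightarrow> (\<And>i. i < q \<Longrightarrow> w i \<bullet> x = 0) \<Longrightarrow>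
      ?\<alpha> * (x \<bullet> x) \<le> x \<bullet> (L1 *\<^sub>v x)"
    using courant_fischer_lower[OF L1_carrier laplacian_mat_symmetric, of q] q by auto
  \<comment> \<open>This is the transpose of the extension map applied to \<open>w i\<close>: the
    entry at the new vertex is distributed to its two neighbours with weights \<open>a\<close> and
    \<open>b\<close>.\<close>
  define w' where "w' i = vec m (\<lambda>j. w i $ j + (if j = m - 1 then w i $ m * a else 0)
    + (if j = 0 then w i $ m * b else 0))" for i
  have "w' i \<in> carrier_vec m" for i by (simp add: w'_def)
  then obtain y where y: "y \<in> carrier_vec m" "y \<noteq> 0\<^sub>v m" and perp: "\<And>i. i < q \<Longrightarrow> w' i \<bullet> y = 0"
    and up: "y \<bullet> (L2 *\<^sub>v y) \<le> ?\<beta> * (y \<bullet> y)"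
    using courant_fischer_upper[OF L2_carrier laplacian_mat_symmetric q, of w'] by metis
  define t where "t = a * y $ (m - 1) + b * y $ 0"
  let ?x = "extend_vec y t"
  have "w i \<bullet> ?x = w' i \<bullet> y" if "i < q" for i
  proof -
    have "w' i \<bullet> y = (\<Sum>j<m. w i $ j * y $ j + (if j = m - 1 then w i $ m * a * y $ j else 0)
        + (if j = 0 then w i $ m * b * y $ j else 0))"
      using y(1) unfolding scalar_prod_def w'_def atLeast0LessThan
      by (intro sum.cong) (auto simp: algebra_simps)
    also have "\<dots> = (\<Sum>j<m. w i $ j * y $ j) + w i $ m * t"
      using m by (simp add: sum.distrib t_def algebra_simps)
    also have "\<dots> = w i \<bullet> ?x" by (simp add: scalar_prod_def atLeast0LessThan)
    finally show ?thesis by simp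
  qed
  then have "?\<alpha> * (?x \<bullet> ?x) \<le> ?x \<bullet> (L1 *\<^sub>v ?x)" using perp by (intro low) auto
  moreover have "?x \<bullet> (L1 *\<^sub>v ?x) \<le> y \<bullet> (L2 *\<^sub>v y) + ((y $ (m - 1))\<^sup>2 + (y $ 0)\<^sup>2 + t\<^sup>2)"
  proof -
    have "a = 1 \<or> a = -1" "b = 1 \<or> b = -1" "real_of_int (\<sigma>2 {m, 1}) = 1 \<or> real_of_int (\<sigma>2 {m, 1}) = -1"
      using edge_signs by (auto simp: a_def b_def)
    from subdivided_edge_form_le[OF this, of "y $ (m - 1)" "y $ 0"] L1_extend_vec[OF y(1), of t]
    show ?thesis unfolding t_def[symmetric] a_def[symmetric] b_def[symmetric] by linarith
  qed
  moreover have "?x \<bullet> ?x = y \<bullet> y + t\<^sup>2" using extend_vec_norm[OF y(1)] .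
  ultimately have le: "?\<alpha> * (y \<bullet> y + t\<^sup>2) \<le> ?\<beta> * (y \<bullet> y) + (y \<bullet> y + t\<^sup>2)"
    using end_entries_norm[OF y(1)] up by simp
  have pos: "y \<bullet> y > 0" using real_scalar_prod_self_pos[OF y] .
  have "0 \<le> ?\<beta> * (y \<bullet> y)" using L2_nonneg[OF y(1)] up by linarith
  then have "0 \<le> ?\<beta>" using pos by (simp add: zero_le_mult_iff)
  \<comment> \<open>In \<open>le\<close> the factor of \<open>?\<beta>\<close> is only
    \<open>y \<bullet> y\<close>; since \<open>?\<beta>\<close> is nonnegative it may be enlarged to
    \<open>y \<bullet> y + t\<^sup>2\<close>, the norm on the other side.\<close>
  then have "0 \<le> ?\<beta> * t\<^sup>2" by simp
  then have "(?\<alpha> - 1) * (y \<bullet> y + t\<^sup>2) \<le> ?\<beta> * (y \<bullet> y + t\<^sup>2)"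
    using le by (simp add: algebra_simps)
  moreover have "0 < y \<bullet> y + t\<^sup>2" using pos by (simp add: add_pos_nonneg)
  ultimately show ?thesis using mult_right_le_imp_le by blast
qed

text \<open>Vanishing at the new vertex is one condition more than the \<open>q\<close> conditions
  for \<open>L2\<close>, which shifts the index for \<open>L1\<close> to
  \<open>Suc q\<close>.\<close>

lemma spectrum_upper:
  assumes q: "q < m"
  shows "ordered_spectrum L2 ! q \<le> ordered_spectrum L1 ! Suc q + 1"
proof -
  let ?\<alpha> = "ordered_spectrum L1 ! Suc q" and ?\<beta> = "ordered_spectrum L2 ! q"
  obtain w where w: "\<And>i. i < q \<Longrightarrow> w i \<in> carrier_vec m"
    and low: "\<And>x. x \<in> carrier_vec m \<Longrightarrow> (\<And>i. i < q \<Longrightarrow> w i \<bullet> x = 0) \<Longrightarrow>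
      ?\<beta> * (x \<bullet> x) \<le> x \<bullet> (L2 *\<^sub>v x)"
    using courant_fischer_lower[OF L2_carrier laplacian_mat_symmetric q] by auto
  define w' where "w' i = (if i < q then extend_vec (w i) 0 else unit_vec (m + 1) m)" for i
  have "w' i \<in> carrier_vec (m + 1)" for i by (simp add: w'_def)
  then obtain x where x: "x \<in> carrier_vec (m + 1)" "x \<noteq> 0\<^sub>v (m + 1)"
    and perp: "\<And>i. i < Suc q \<Longrightarrow> w' i \<bullet> x = 0"
    and up: "x \<bullet> (L1 *\<^sub>v x) \<le> ?\<alpha> * (x \<bullet> x)"
    using courant_fischer_upper[OF L1_carrier laplacian_mat_symmetric, of "Suc q" w'] q
    by (metis Suc_eq_plus1 Suc_mono)
  define y where "y = vec m (\<lambda>i. x $ i)"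
  have y: "y \<in> carrier_vec m" by (simp add: y_def)
  have "x $ m = 0" using perp[of q] x by (simp add: w'_def)
  then have xy: "x = extend_vec y 0" using x by (intro eq_vecI) (auto simp: y_def less_Suc_eq)
  have "w i \<bullet> y = 0" if "i < q" for i
    using perp[of i] that w[OF that] y by (simp add: xy w'_def scalar_prod_def)
  then have "?\<beta> * (y \<bullet> y) \<le> y \<bullet> (L2 *\<^sub>v y)" using y by (intro low) auto
  moreover have "y \<bullet> (L2 *\<^sub>v y) \<le> x \<bullet> (L1 *\<^sub>v x) + ((y $ (m - 1))\<^sup>2 + (y $ 0)\<^sup>2)"
  proof -
    \<comment> \<open>With \<open>t = 0\<close> the forms of \<open>L2\<close> and \<open>L1\<close>
      differ exactly by the cross term of the closing edge. Nonnegativity of the square with the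
      opposite sign bounds it by the two end entries.\<close>
    have "- real_of_int (\<sigma>2 {m, 1}) = 1 \<or> - real_of_int (\<sigma>2 {m, 1}) = -1"
      using edge_signs(3) by auto
    from signed_square_nonneg[OF this, of "y $ (m - 1)" "y $ 0"] L1_extend_vec[OF y, of 0]
    show ?thesis by (simp add: xy)
  qed
  moreover have "x \<bullet> x = y \<bullet> y" using extend_vec_norm[OF y, of 0] by (simp add: xy)
  ultimately have "?\<beta> * (y \<bullet> y) \<le> (?\<alpha> + 1) * (y \<bullet> y)"
    using end_entries_norm[OF y] up by (simp add: algebra_simps)
  moreover have "0 < y \<bullet> y" using real_scalar_prod_self_pos[OF x] \<open>x \<bullet> x = y \<bullet> y\<close> by simp
  ultimately show ?thesis using mult_right_le_imp_le by blast
qed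

end

theorem theorem2p4:
  fixes m :: nat
    and \<sigma>1 \<sigma>2 :: "nat set \<Rightarrow> int"
    and \<alpha> \<beta> :: "real list"
  assumes "m \<ge> 3"
    and "signed_graph (cycle_vertices (m + 1)) (cycle_edges (m + 1)) \<sigma>1"
    and "signed_graph (cycle_vertices m) (cycle_edges m) \<sigma>2"
    and "\<forall>e \<in> cycle_edges m - {{1, m}}. \<sigma>2 e = \<sigma>1 e"
    and "\<alpha> = laplacian_spectrum (cycle_vertices (m + 1)) (cycle_edges (m + 1)) \<sigma>1"
    and "\<beta> = laplacian_spectrum (cycle_vertices m) (cycle_edges m) \<sigma>2"
  shows "\<forall>p \<in> {1..m}. \<alpha> ! (p - 1) - 1 \<le> \<beta> ! (p - 1) \<and> \<beta> ! (p - 1) \<le> \<alpha> ! p + 2"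
proof
  fix p assume "p \<in> {1..m}"
  \<comment> \<open>Lists are indexed from 0, so \<open>\<alpha> ! p\<close> is the eigenvalue
    number \<open>p + 1\<close>, matching \<open>Suc q\<close> for \<open>q = p - 1\<close>.\<close>
  then have "p - 1 < m" "Suc (p - 1) = p" by auto
  then show "\<alpha> ! (p - 1) - 1 \<le> \<beta> ! (p - 1) \<and> \<beta> ! (p - 1) \<le> \<alpha> ! p + 2"
    using spectrum_lower[OF assms(1-4), of "p - 1"] spectrum_upper[OF assms(1-4), of "p - 1"]
    unfolding assms(5,6) laplacian_spectrum_def by simp
qed

end
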